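(* Let $r\ge2$, let $A_1,\ldots,A_r$ be positive semidefinite operators on a finite-dimensional Hilbert space, and let $\kappa:=3\max_{1\le i<j\le r}\sqrt{\operatorname{Tr}A_i+\operatorname{Tr}A_j}$. Then $$P_e^*(A_1,\ldots,A_r)\le2^{r-2}P_e^*(A_1,A_2)+\kappa\sum_{k=2}^{r-1}2^{r-1-k}\sum_{l=1}^k\sqrt{P_e^*(A_l,A_{k+1})}.$$ If $A_k$ is of rank one for $k=3,\ldots,r$, then $$P_e^*(A_1,\ldots,A_r)\le2^{r-2}P_e^*(A_1,A_2)+\kappa'\sum_{k=2}^{r-1}2^{r-1-k}\sum_{l=1}^kP_e^*(A_l,A_{k+1}),$$ where $\kappa':=3\operatorname{Tr}A_0/\big(\min_{3\le i\le r}\operatorname{Tr}A_i\big)$ and $A_0:=\sum_{i=1}^rA_i$ (for $r=2$ the sum over $k$ is empty and $\kappa'$ plays no role).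
   Context: A POVM $\{E_1,\ldots,E_m\}$ on a finite-dimensional Hilbert space is a family of positive semidefinite operators with $E_1+\cdots+E_m\le I$. For positive semidefinite $A_1,\ldots,A_m$, the optimal error is $P_e^*(A_1,\ldots,A_m):=\min\{\sum_{i=1}^m\operatorname{Tr}A_i(I-E_i):\{E_1,\ldots,E_m\}\text{ POVM}\}$; for two operators this equals $\frac12\operatorname{Tr}(A+B)-\frac12\|A-B\|_1$ with the trace norm. *)

theory Defs
  imports "HOL-Analysis.Analysis"
begin

text \<open>
  A finite-dimensional Hilbert space is represented by \<open>complex ^ 'n\<close> with the standard inner
  product; operators on it are matrices of type \<open>complex ^ 'n ^ 'n\<close>. The library provides only
  the real inner product on this type, hence the following definition
  (conjugate-linear in the first argument).
\<close>

definition cinner :: "complex ^ 'n \<Rightarrow> complex ^ 'n \<Rightarrow> complex" where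
  "cinner x y = (\<Sum>i\<in>UNIV. cnj (x $ i) * y $ i)"

text \<open>Over the complex numbers, self-adjointness is implied by the following condition.\<close>

definition psd :: "complex ^ 'n ^ 'n \<Rightarrow> bool" where
  "psd M \<longleftrightarrow> (\<forall>x. cinner x (M *v x) \<in> \<real>\<^sub>\<ge>\<^sub>0)"

text \<open>Elements of a POVM need only sum to at most the identity.\<close>

definition povm :: "(complex ^ 'n ^ 'n) list \<Rightarrow> bool" where
  "povm E \<longleftrightarrow> (\<forall>M\<in>set E. psd M) \<and> psd (mat 1 - sum_list E)"

text \<open>The real part of the trace: the trace of a positive semidefinite operator, or of a
  product of two of them, is real.\<close>

definition Tr :: "complex ^ 'n ^ 'n \<Rightarrow> real" where
  "Tr M = Re (trace M)"

definition error_prob ::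
  "(complex ^ 'n ^ 'n) list \<Rightarrow> (complex ^ 'n ^ 'n) list \<Rightarrow> real" where
  "error_prob A E = (\<Sum>i<length A. Tr (A ! i ** (mat 1 - E ! i)))"

text \<open>The infimum is a minimum, see \<open>opt_error_attained\<close> and \<open>opt_error_le\<close> below.\<close>

definition opt_error :: "(complex ^ 'n ^ 'n) list \<Rightarrow> real" where
  "opt_error A = Inf {error_prob A E | E. povm E \<and> length E = length A}"


lemma nonneg_Reals_closed: "closed (\<real>\<^sub>\<ge>\<^sub>0 :: complex set)"
proof -
  have "(\<real>\<^sub>\<ge>\<^sub>0 :: complex set) = {z. 0 \<le> Re z} \<inter> {z. Im z = 0}"
    by (auto simp: complex_nonneg_Reals_iff)
  moreover have "closed {z. 0 \<le> Re z}" "closed {z. Im z = 0}"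
    by (intro closed_Collect_le closed_Collect_eq continuous_intros)+
  ultimately show ?thesis by auto
qed

lemma cinner_matrix:
  "cinner x (M *v x) = (\<Sum>i\<in>UNIV. \<Sum>j\<in>UNIV. cnj (x $ i) * M $ i $ j * x $ j)"
  by (simp add: cinner_def matrix_vector_mult_def sum_distrib_left mult.assoc)

lemma closed_psd: "closed {M :: complex ^ 'n ^ 'n. psd M}"
proof -
  have "closed ((\<lambda>M :: complex ^ 'n ^ 'n. cinner x (M *v x)) -` \<real>\<^sub>\<ge>\<^sub>0)" for x
    unfolding cinner_matrix
    by (intro continuous_closed_vimage nonneg_Reals_closed continuous_intros
        continuous_at_imp_continuous_on)
  then have "closed (\<Inter>x. (\<lambda>M :: complex ^ 'n ^ 'n. cinner x (M *v x)) -` \<real>\<^sub>\<ge>\<^sub>0)" by auto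
  moreover have "{M. psd M} = (\<Inter>x. (\<lambda>M :: complex ^ 'n ^ 'n. cinner x (M *v x)) -` \<real>\<^sub>\<ge>\<^sub>0)"
    by (auto simp: psd_def)
  ultimately show ?thesis by simp
qed

lemma psd_0: "psd 0"
  by (simp add: psd_def cinner_def)

lemma psd_mat_1: "psd (mat 1)"
proof -
  have "cinner x (mat 1 *v x) = of_real (\<Sum>i\<in>UNIV. (cmod (x $ i))\<^sup>2)" for x :: "complex ^ 'n"
    by (simp add: cinner_def mult.commute[of "cnj _"] flip: complex_norm_square)
  then show ?thesis
    unfolding psd_def by (metis nonneg_Reals_of_real_iff sum_nonneg zero_le_power2)
qed

lemma psd_add: "psd M \<Longrightarrow> psd N \<Longrightarrow> psd (M + N)"
  by (simp add: psd_def cinner_def matrix_vector_mult_add_rdistrib distrib_left sum.distrib)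

lemma psd_sum_list: "\<forall>M\<in>set E. psd M \<Longrightarrow> psd (sum_list E)"
  by (induction E) (auto simp: psd_0 psd_add)

lemma povm_elem_le:
  assumes "povm E" "M \<in> set E"
  shows "psd (mat 1 - M)"
proof -
  obtain xs ys where E: "E = xs @ M # ys"
    using assms(2) by (meson split_list)
  have "psd (sum_list (xs @ ys))"
    by (rule psd_sum_list) (use assms(1) E in \<open>auto simp: povm_def\<close>)
  with assms(1) have "psd (mat 1 - sum_list E + sum_list (xs @ ys))"
    by (auto simp: povm_def intro: psd_add)
  then show ?thesis by (simp add: E algebra_simps)
qed

lemma psd_le_1_bound:
  fixes M :: "complex ^ 'n ^ 'n"
  assumes "psd M" "psd (mat 1 - M)"
  shows "cmod (M $ i $ j) \<le> 2"
proof -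
  have form: "cinner x (N *v x) = N $ i $ i + (if i = j then 0 else
        c * N $ i $ j + cnj c * N $ j $ i + cnj c * c * N $ j $ j)"
    if x: "x = (\<chi> k. if k = i then 1 else if k = j then c else 0)"
    for x and N :: "complex ^ 'n ^ 'n" and c
  proof -
    have supp: "(\<Sum>k\<in>UNIV. g k) = (\<Sum>k\<in>{i, j}. g k)" if "\<And>k. k \<notin> {i, j} \<Longrightarrow> g k = 0"
      for g :: "'n \<Rightarrow> complex"
      by (rule sum.mono_neutral_right) (use that in auto)
    have "cinner x (N *v x) = (\<Sum>k\<in>{i,j}. \<Sum>l\<in>{i,j}. cnj (x $ k) * N $ k $ l * x $ l)"
    proof -
      have "cinner x (N *v x) = (\<Sum>k\<in>{i,j}. \<Sum>l\<in>UNIV. cnj (x $ k) * N $ k $ l * x $ l)"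
        unfolding cinner_matrix by (rule supp) (simp add: x)
      also have "\<dots> = (\<Sum>k\<in>{i,j}. \<Sum>l\<in>{i,j}. cnj (x $ k) * N $ k $ l * x $ l)"
        by (intro sum.cong[OF refl] supp) (simp add: x)
      finally show ?thesis .
    qed
    then show ?thesis
      by (cases "i = j") (simp_all add: x algebra_simps)
  qed
  have pos: "cinner x (M *v x) \<in> \<real>\<^sub>\<ge>\<^sub>0" "cinner x ((mat 1 - M) *v x) \<in> \<real>\<^sub>\<ge>\<^sub>0" for x
    using assms by (auto simp: psd_def)
  note p = pos[of "\<chi> k. if k = i then 1 else if k = j then c else 0" for c,
      unfolded form[OF refl]]
  show ?thesis
  proof (cases "i = j")
    case True
    then show ?thesis
      using p[of 0] cmod_le[of "M $ i $ i"] by (simp add: complex_nonneg_Reals_iff mat_def)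
  next
    case False
    from p[of 1] p[of \<i>] p[of "-1"] p[of "-\<i>"] False
    have "\<bar>Re (M $ i $ j)\<bar> \<le> 1" "\<bar>Im (M $ i $ j)\<bar> \<le> 1"
      by (auto simp: complex_nonneg_Reals_iff mat_def)
    then show ?thesis
      using cmod_le[of "M $ i $ j"] by linarith
  qed
qed

lemma compact_effects: "compact {M :: complex ^ 'n ^ 'n. psd M \<and> psd (mat 1 - M)}"
proof -
  have "closed ((\<lambda>M :: complex ^ 'n ^ 'n. mat 1 - M) -` {M. psd M})"
    by (intro continuous_closed_vimage closed_psd continuous_intros)
  then have "closed ({M. psd M} \<inter> (\<lambda>M :: complex ^ 'n ^ 'n. mat 1 - M) -` {M. psd M})"
    by (intro closed_Int closed_psd)
  moreover have "norm M \<le> (\<Sum>i\<in>(UNIV :: 'n set). \<Sum>j\<in>(UNIV :: 'n set). 2)"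
    if "psd M" "psd (mat 1 - M)" for M :: "complex ^ 'n ^ 'n"
  proof -
    have "norm M \<le> (\<Sum>i\<in>UNIV. norm (M $ i))"
      unfolding norm_vec_def[of M] by (rule L2_set_le_sum) simp
    also have "\<dots> \<le> (\<Sum>i\<in>UNIV. \<Sum>j\<in>UNIV. cmod (M $ i $ j))"
      by (rule sum_mono) (simp add: norm_vec_def L2_set_le_sum)
    also have "\<dots> \<le> (\<Sum>i\<in>(UNIV :: 'n set). \<Sum>j\<in>(UNIV :: 'n set). 2)"
      by (intro sum_mono psd_le_1_bound that)
    finally show ?thesis .
  qed
  ultimately show ?thesis
    unfolding compact_eq_bounded_closed bounded_iff
    by (auto simp: vimage_def Collect_conj_eq)
qed

lemma error_prob_attained:
  fixes A :: "(complex ^ 'n ^ 'n) list"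
  shows "\<exists>E. povm E \<and> length E = length A \<and>
    (\<forall>F. povm F \<and> length F = length A \<longrightarrow> error_prob A E \<le> error_prob A F)"
proof -
  define m where "m = length A"
  define B where "B i = (if i < m then {M :: complex ^ 'n ^ 'n. psd M \<and> psd (mat 1 - M)} else {0})"
    for i :: nat
  define S where "S = {f :: nat \<Rightarrow> complex ^ 'n ^ 'n. f \<in> PiE UNIV B \<and> psd (mat 1 - (\<Sum>i<m. f i))}"
  define err where "err f = (\<Sum>i<m. Tr (A ! i ** (mat 1 - f i)))"
    for f :: "nat \<Rightarrow> complex ^ 'n ^ 'n"
  have "compact (PiE UNIV B)"
    using compactin_PiE[of "\<lambda>_. euclidean" UNIV B] compact_effects
    by (auto simp: B_def euclidean_product_topology compactin_euclidean_iff)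
  moreover have "closed ((\<lambda>f :: nat \<Rightarrow> complex ^ 'n ^ 'n. mat 1 - (\<Sum>i<m. f i)) -` {M. psd M})"
    by (rule closed_vimage[OF closed_psd])
       (intro continuous_intros continuous_on_product_coordinates)
  moreover have "S = PiE UNIV B \<inter>
      ((\<lambda>f :: nat \<Rightarrow> complex ^ 'n ^ 'n. mat 1 - (\<Sum>i<m. f i)) -` {M. psd M})"
    by (auto simp: S_def)
  ultimately have "compact S"
    by (simp add: compact_Int_closed)
  moreover have "(\<lambda>_. 0) \<in> S"
    by (auto simp: S_def B_def psd_0 psd_mat_1)
  then have "S \<noteq> {}" by auto
  moreover have "continuous_on S err"
    unfolding err_def Tr_def trace_def matrix_matrix_mult_def
    by (simp, intro continuous_intros continuous_on_subset[OF continuous_on_product_coordinates])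
       auto
  ultimately obtain f where f: "f \<in> S" "\<And>g. g \<in> S \<Longrightarrow> err f \<le> err g"
    using continuous_attains_inf[of S err] by metis
  have sum: "sum_list (map g [0..<m]) = (\<Sum>i<m. g i)" for g :: "nat \<Rightarrow> complex ^ 'n ^ 'n"
    by (simp add: interv_sum_list_conv_sum_set_nat atLeast0LessThan)
  have "povm (map f [0..<m])"
    using f(1) by (auto simp: povm_def S_def B_def PiE_iff sum split: if_splits)
  moreover have "error_prob A (map f [0..<m]) = err f"
    by (simp add: error_prob_def err_def m_def)
  moreover have "err f \<le> error_prob A F" if F: "povm F" "length F = m" for F
  proof -
    define g where "g i = (if i < m then F ! i else 0)" for i
    have F_eq: "F = map g [0..<m]"
      using F by (intro nth_equalityI) (auto simp: g_def)
    have "g \<in> S"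
      using F povm_elem_le[OF F(1)] sum[of g]
      by (auto simp: S_def B_def g_def povm_def F_eq[symmetric])
    then have "err f \<le> err g" by (rule f(2))
    also have "err g = error_prob A F"
      by (simp add: error_prob_def err_def m_def g_def)
    finally show ?thesis .
  qed
  ultimately show ?thesis
    by (intro exI[of _ "map f [0..<m]"]) (auto simp: m_def)
qed

lemma opt_error_attained:
  "\<exists>E. povm E \<and> length E = length A \<and> error_prob A E = opt_error A"
proof -
  obtain E where E: "povm E" "length E = length A"
    "\<And>F. povm F \<Longrightarrow> length F = length A \<Longrightarrow> error_prob A E \<le> error_prob A F"
    using error_prob_attained[of A] by blast
  have "opt_error A = error_prob A E"
    unfolding opt_error_def by (rule cInf_eq_minimum) (use E in auto)
  with E show ?thesis by metis
qed

lemma opt_error_le: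
  assumes "povm E" "length E = length A"
  shows "opt_error A \<le> error_prob A E"
  unfolding opt_error_def
proof (rule cInf_lower)
  show "bdd_below {error_prob A E | E. povm E \<and> length E = length A}"
    using error_prob_attained[of A] by (auto simp: bdd_below_def)
qed (use assms in auto)

end

theory Submission
  imports Defs
begin

text \<open>
  Given an optimal POVM \<open>E\<^sub>1, \<dots>, E\<^sub>k\<close> for \<open>A\<^sub>1, \<dots>, A\<^sub>k\<close> and an effect \<open>0 \<le> S \<le> 1\<close>, the operators
  \<open>S E\<^sub>1 S, \<dots>, S E\<^sub>k S, 1 - S\<^sup>2\<close> form a POVM for \<open>A\<^sub>1, \<dots>, A\<^sub>k, B\<close>. Since
  \<open>1 - S E S \<le> 2 (1 - E) + 3 (1 - S)\<close>, its error is at most twice the error of \<open>E\<close> plus three times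
  the error of the test \<open>S\<close> of \<open>\<Sum> A\<^sub>l\<close> against \<open>B\<close>. It remains to choose \<open>S\<close>.

  In general, let \<open>T\<^sub>l\<close> be an optimal test of \<open>A\<^sub>l\<close> against \<open>B\<close>, with error \<open>p\<^sub>l\<close>, put
  \<open>X\<^sub>l = a\<^sub>l (1 - T\<^sub>l) + T\<^sub>l / a\<^sub>l\<close>, \<open>Z\<^sub>l = (1 - T\<^sub>l) / a\<^sub>l + a\<^sub>l T\<^sub>l\<close>, \<open>Y = \<Sum> Z\<^sub>l\<close>, and take
  \<open>S = 1 - R\<close> with \<open>R = (1 + Y\<^sup>2)\<^sup>-\<^sup>1\<close>. Then \<open>2 R \<le> X\<^sub>l\<close> for all \<open>l\<close> and \<open>2 S \<le> Y\<close>, and the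
  choice \<open>a\<^sub>l\<^sup>2 = (Tr A\<^sub>l + Tr B) / p\<^sub>l\<close> bounds the error of \<open>S\<close> by
  \<open>\<Sum> sqrt ((Tr A\<^sub>l + Tr B) p\<^sub>l)\<close>.

  If \<open>B = |x\<rangle>\<langle>x|\<close> has rank one, take \<open>S = 1 - B / Tr B\<close> instead. Its error
  \<open>\<Sum> \<langle>x, A\<^sub>l x\<rangle> / Tr B\<close> is controlled by \<open>\<langle>x, A\<^sub>l x\<rangle> \<le> (Tr A\<^sub>l + Tr B) p\<^sub>l\<close>, which follows from the
  Cauchy--Schwarz inequality for the forms \<open>T\<^sub>l\<close> and \<open>1 - T\<^sub>l\<close>.
\<close>

section \<open>Matrices and positive semidefiniteness\<close>

lemma matrix_mult_add_right: "(A + B) ** C = A ** C + B ** (C :: complex ^ 'k ^ 'n)"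
  by (simp add: matrix_matrix_mult_def vec_eq_iff distrib_right sum.distrib)

lemma matrix_mult_diff_left: "A ** (B - C) = A ** B - A ** (C :: complex ^ 'k ^ 'n)"
  by (simp add: matrix_matrix_mult_def vec_eq_iff right_diff_distrib sum_subtractf)

lemma matrix_mult_diff_right: "(A - B) ** C = A ** C - B ** (C :: complex ^ 'k ^ 'n)"
  by (simp add: matrix_matrix_mult_def vec_eq_iff left_diff_distrib sum_subtractf)

lemma matrix_mult_scaleR_left: "(c *\<^sub>R A) ** B = c *\<^sub>R (A ** (B :: complex ^ 'k ^ 'n))"
  by (simp add: matrix_matrix_mult_def vec_eq_iff scaleR_sum_right)

lemma matrix_mult_scaleR_right: "A ** (c *\<^sub>R B) = c *\<^sub>R (A ** (B :: complex ^ 'k ^ 'n))"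
  by (simp add: matrix_matrix_mult_def vec_eq_iff scaleR_sum_right)

lemmas matrix_ring_simps =
  matrix_add_ldistrib matrix_mult_add_right matrix_mult_diff_left matrix_mult_diff_right
  matrix_mult_scaleR_left matrix_mult_scaleR_right matrix_mul_assoc

definition dagger :: "complex ^ 'n ^ 'm \<Rightarrow> complex ^ 'm ^ 'n" where
  "dagger M = (\<chi> i j. cnj (M $ j $ i))"

lemma dagger_dagger [simp]: "dagger (dagger M) = M"
  by (simp add: dagger_def vec_eq_iff)

lemma dagger_mult: "dagger (M ** N) = dagger N ** dagger M"
  by (simp add: dagger_def matrix_matrix_mult_def vec_eq_iff mult.commute)

lemma dagger_add: "dagger (M + N) = dagger M + dagger N"
  by (simp add: dagger_def vec_eq_iff)

lemma dagger_diff: "dagger (M - N) = dagger M - dagger N"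
  by (simp add: dagger_def vec_eq_iff)

lemma dagger_scaleR: "dagger (c *\<^sub>R M) = c *\<^sub>R dagger M"
  by (simp add: dagger_def vec_eq_iff)

lemma dagger_mat_1 [simp]: "dagger (mat 1) = mat 1"
  by (simp add: dagger_def mat_def vec_eq_iff)

lemmas dagger_simps = dagger_mult dagger_add dagger_diff dagger_scaleR

lemma matrix_vector_scaleR_left: "(c *\<^sub>R M) *v x = c *\<^sub>R (M *v (x :: complex ^ 'n))"
  by (simp add: matrix_vector_mult_def vec_eq_iff scaleR_sum_right)

lemma cinner_add_left: "cinner (x + y) z = cinner x z + cinner y z"
  by (simp add: cinner_def distrib_right sum.distrib)

lemma cinner_add_right: "cinner x (y + z) = cinner x y + cinner x z"
  by (simp add: cinner_def distrib_left sum.distrib)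

lemma cinner_diff_left: "cinner (x - y) z = cinner x z - cinner y z"
  by (simp add: cinner_def left_diff_distrib sum_subtractf)

lemma cinner_diff_right: "cinner x (y - z) = cinner x y - cinner x z"
  by (simp add: cinner_def right_diff_distrib sum_subtractf)

lemma cinner_scale_left: "cinner (c *s x) y = cnj c * cinner x y"
  by (simp add: cinner_def sum_distrib_left mult.assoc)

lemma cinner_scale_right: "cinner x (c *s y) = c * cinner x y"
  by (simp add: cinner_def sum_distrib_left mult.left_commute)

lemma cinner_scaleR_right: "cinner x (c *\<^sub>R y) = c * cinner x y"
  by (simp add: cinner_def sum_distrib_left mult.left_commute scaleR_conv_of_real[where 'a = complex])

lemma cnj_cinner: "cnj (cinner x y) = cinner y x"
  by (simp add: cinner_def mult.commute)

lemma cinner_self: "cinner x x = of_real (\<Sum>i\<in>UNIV. (cmod (x $ i))\<^sup>2)"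
  by (simp add: cinner_def mult.commute[of "cnj _"] flip: complex_norm_square)

lemma cinner_self_eq_0: "cinner x x = 0 \<longleftrightarrow> x = 0"
proof
  assume "cinner x x = 0"
  then have "(\<Sum>i\<in>UNIV. (cmod (x $ i))\<^sup>2) = 0"
    unfolding cinner_self of_real_eq_0_iff .
  then show "x = 0"
    by (subst (asm) sum_nonneg_eq_0_iff) (auto simp: vec_eq_iff)
qed (simp add: cinner_def)

lemma cinner_axis: "cinner (axis i 1) x = x $ i"
proof -
  have "cnj (axis i 1 $ j) * x $ j = (if j = i then x $ j else 0)" for j
    by (simp add: axis_def)
  then show ?thesis
    by (simp add: cinner_def)
qed

lemma cinner_dagger: "cinner x (M *v y) = cinner (dagger M *v x) y"
proof -
  have "cinner x (M *v y) = (\<Sum>i\<in>UNIV. \<Sum>j\<in>UNIV. cnj (x $ i) * (M $ i $ j * y $ j))"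
    by (simp add: cinner_def matrix_vector_mult_def sum_distrib_left)
  also have "\<dots> = (\<Sum>j\<in>UNIV. \<Sum>i\<in>UNIV. cnj (x $ i) * (M $ i $ j * y $ j))"
    by (rule sum.swap)
  also have "\<dots> = cinner (dagger M *v x) y"
    by (simp add: cinner_def matrix_vector_mult_def dagger_def sum_distrib_right sum_distrib_left mult_ac)
  finally show ?thesis .
qed

lemma matrix_vector_mult_axis_1: "(M *v axis j 1) $ i = (M :: complex ^ 'n ^ 'm) $ i $ j"
proof -
  have "M $ i $ k * axis j 1 $ k = (if k = j then M $ i $ k else 0)" for k
    by (simp add: axis_def)
  then show ?thesis
    by (simp add: matrix_vector_mult_def)
qed

text \<open>By polarization with \<open>x + y\<close> and \<open>x + \<i> y\<close>; false over the reals.\<close>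

lemma quadratic_form_eq_0:
  assumes "\<And>x. cinner x (N *v x) = 0"
  shows "N = 0"
proof -
  have "cinner x (N *v y) = 0" for x y
  proof -
    have 1: "cinner x (N *v y) + cinner y (N *v x) = 0"
      using assms[of "x + y"]
      by (simp add: cinner_add_left cinner_add_right matrix_vector_right_distrib assms add.commute)
    have "cinner (x + \<i> *s y) (N *v (x + \<i> *s y)) = \<i> * cinner x (N *v y) - \<i> * cinner y (N *v x)"
      by (simp add: cinner_add_left cinner_add_right matrix_vector_right_distrib assms
          cinner_scale_left cinner_scale_right vector_scalar_commute)
    then have "\<i> * (cinner x (N *v y) - cinner y (N *v x)) = 0"
      by (simp add: assms right_diff_distrib)
    with 1 show ?thesis by simp
  qed
  then have "cinner (axis i 1) (N *v axis j 1) = 0" for i j .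
  then show ?thesis
    by (simp add: cinner_axis matrix_vector_mult_axis_1 vec_eq_iff)
qed

text \<open>The quadratic form of \<open>dagger M\<close> is the complex conjugate of that of
  \<open>M\<close>. Since the latter is real, \<open>dagger M - M\<close> has zero form and vanishes
  by polarization.\<close>

lemma psd_dagger:
  assumes "psd M"
  shows "dagger M = M"
proof -
  have "cinner x ((dagger M - M) *v x) = 0" for x
  proof -
    have "cinner x (dagger M *v x) = cnj (cinner x (M *v x))"
      by (simp add: cinner_dagger[of x "dagger M"] cnj_cinner)
    also have "\<dots> = cinner x (M *v x)"
      using assms by (simp add: psd_def complex_nonneg_Reals_iff complex_eq_iff)
    finally show ?thesis
      by (simp add: matrix_vector_mult_diff_rdistrib cinner_diff_right)
  qed
  then have "dagger M - M = 0" by (rule quadratic_form_eq_0)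
  then show ?thesis by simp
qed

lemma psd_Re_nonneg: "psd M \<Longrightarrow> 0 \<le> Re (cinner x (M *v x))"
  by (simp add: psd_def complex_nonneg_Reals_iff)

lemma psd_of_real: "psd M \<Longrightarrow> cinner x (M *v x) = of_real (Re (cinner x (M *v x)))"
  by (simp add: psd_def complex_nonneg_Reals_iff complex_eq_iff)

lemma psdI:
  assumes "dagger M = M" "\<And>x. 0 \<le> Re (cinner x (M *v x))"
  shows "psd M"
proof -
  have "cnj (cinner x (M *v x)) = cinner x (M *v x)" for x
    by (metis assms(1) cinner_dagger cnj_cinner)
  then show ?thesis
    using assms(2) by (simp add: psd_def complex_nonneg_Reals_iff complex_eq_iff)
qed

lemma psd_congruence: "psd M \<Longrightarrow> psd (dagger C ** M ** C)"
  by (simp add: psd_def cinner_dagger[of _ "dagger C"] flip: matrix_vector_mul_assoc)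

lemma psd_scaleR: "psd M \<Longrightarrow> 0 \<le> c \<Longrightarrow> psd (c *\<^sub>R M)"
  by (simp add: psd_def matrix_vector_scaleR_left cinner_scaleR_right
      complex_nonneg_Reals_iff)

lemma psd_square: "dagger M = M \<Longrightarrow> psd (M ** M)"
  using psd_congruence[OF psd_mat_1, of M] by simp

lemma psd_congruence_self: "psd M \<Longrightarrow> dagger C = C \<Longrightarrow> psd (C ** M ** C)"
  using psd_congruence[of M C] by simp

lemma psd_sum: "(\<And>i. i \<in> I \<Longrightarrow> psd (M i)) \<Longrightarrow> psd (sum M I)"
  by (induction I rule: infinite_finite_induct) (simp_all add: psd_0 psd_add)

section \<open>Rank one operators and the Cauchy-Schwarz inequality\<close>

definition outer :: "complex ^ 'n \<Rightarrow> complex ^ 'n ^ 'n" where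
  "outer v = (\<chi> i j. v $ i * cnj (v $ j))"

lemma outer_mult_vec: "outer v *v x = cinner v x *s v"
  by (simp add: outer_def matrix_vector_mult_def cinner_def vec_eq_iff
      sum_distrib_left sum_distrib_right mult_ac)

lemma dagger_outer [simp]: "dagger (outer v) = outer v"
  by (simp add: dagger_def outer_def vec_eq_iff)

lemma cinner_outer: "cinner x (outer v *v x) = of_real ((cmod (cinner v x))\<^sup>2)"
  by (simp only: outer_mult_vec cinner_scale_right complex_norm_square cnj_cinner)

lemma psd_outer: "psd (outer v)"
  by (rule psdI) (simp_all add: cinner_outer)

lemma outer_eq_0: "outer v = 0 \<Longrightarrow> v = 0"
  by (auto simp: outer_def vec_eq_iff)

lemma outer_scaleR: "outer (c *\<^sub>R v) = c\<^sup>2 *\<^sub>R outer v"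
  by (simp add: outer_def vec_eq_iff power2_eq_square)

lemma outer_square: "outer v ** outer v = Re (cinner v v) *\<^sub>R outer v"
proof -
  have "(outer v ** outer v) *v x = (Re (cinner v v) *\<^sub>R outer v) *v x" for x
  proof -
    have "(outer v ** outer v) *v x = cinner v x *s (cinner v v *s v)"
      by (simp add: outer_mult_vec vector_scalar_commute flip: matrix_vector_mul_assoc)
    also have "cinner v v = of_real (Re (cinner v v))"
      by (simp add: cinner_self)
    finally show ?thesis
      by (simp add: outer_mult_vec matrix_vector_scaleR_left vec_eq_iff
          scaleR_conv_of_real[where 'a = complex])
  qed
  then show ?thesis by (simp add: matrix_eq)
qed

lemma psd_neg_eq_0:
  assumes "psd M" "psd (- M)"
  shows "M = 0"
proof (rule quadratic_form_eq_0)
  fix x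
  have "cinner x ((- M) *v x) = - cinner x (M *v x)"
    by (simp add: matrix_vector_mult_def cinner_def sum_negf)
  then show "cinner x (M *v x) = 0"
    using psd_of_real[OF assms(1), of x] psd_Re_nonneg[OF assms(1), of x]
      psd_Re_nonneg[OF assms(2), of x]
    by (simp add: complex_eq_iff)
qed

lemma psd_cauchy_schwarz_vec:
  assumes "psd M"
  shows "(cmod (cinner y (M *v x)))\<^sup>2 \<le> Re (cinner x (M *v x)) * Re (cinner y (M *v y))"
proof -
  define a where "a = Re (cinner x (M *v x))"
  define b where "b = Re (cinner y (M *v y))"
  define z where "z = cinner y (M *v x)"
  have a: "cinner x (M *v x) = of_real a" and b: "cinner y (M *v y) = of_real b"
    using psd_of_real[OF assms] by (simp_all add: a_def b_def)
  have zc: "cinner x (M *v y) = cnj z"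
    using psd_dagger[OF assms] by (simp add: z_def cnj_cinner cinner_dagger[of x M y])
  have ab: "0 \<le> a" "0 \<le> b"
    using psd_Re_nonneg[OF assms] by (simp_all add: a_def b_def)
  have *: "0 \<le> c\<^sup>2 * a - 2 * c * d * (cmod z)\<^sup>2 + d\<^sup>2 * (cmod z)\<^sup>2 * b" for c d :: real
  proof -
    \<comment> \<open>The factor \<open>z\<close> aligns the phases, so that the cross terms become
      real multiples of \<open>(cmod z)\<^sup>2\<close>.\<close>
    define u where "u = of_real c *s x - (of_real d * z) *s y"
    have "cinner u (M *v u) = (of_real c)\<^sup>2 * of_real a
        - 2 * of_real c * of_real d * (z * cnj z) + (of_real d)\<^sup>2 * (z * cnj z) * of_real b"
      unfolding u_def
      by (simp add: cinner_diff_left cinner_diff_right cinner_scale_left cinner_scale_right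
          matrix_vector_mult_diff_distrib vector_scalar_commute a b zc
          z_def[symmetric] algebra_simps power2_eq_square)
    also have "\<dots> = of_real (c\<^sup>2 * a - 2 * c * d * (cmod z)\<^sup>2 + d\<^sup>2 * (cmod z)\<^sup>2 * b)"
      by (simp add: complex_norm_square[symmetric])
    finally have "cinner u (M *v u) = \<dots>" .
    then show ?thesis
      using psd_Re_nonneg[OF assms, of u] by simp
  qed
  have "(cmod z)\<^sup>2 \<le> a * b"
  proof (cases "b = 0")
    case True
    \<comment> \<open>For \<open>b = 0\<close> the bound \<open>*\<close> is affine in
      \<open>d\<close>, so a large \<open>d\<close> would make it negative unless \<open>z\<close>
      vanishes.\<close>
    have "(cmod z)\<^sup>2 = 0"
    proof (rule ccontr)
      assume "(cmod z)\<^sup>2 \<noteq> 0"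
      then have "0 < (cmod z)\<^sup>2" by simp
      moreover have "2 * ((a + 1) / (cmod z)\<^sup>2) * (cmod z)\<^sup>2 = 2 * (a + 1)"
        using \<open>(cmod z)\<^sup>2 \<noteq> 0\<close> by simp
      ultimately show False
        using *[of 1 "(a + 1) / (cmod z)\<^sup>2"] True ab by simp
    qed
    then show ?thesis using ab True by simp
  next
    case False
    with ab have "0 < b" by simp
    have "0 \<le> b * (a * b - (cmod z)\<^sup>2)"
      using *[of b 1] by (simp add: algebra_simps power2_eq_square)
    with \<open>0 < b\<close> show ?thesis by (simp add: zero_le_mult_iff)
  qed
  then show ?thesis by (simp add: a_def b_def z_def)
qed

text \<open>Operator form of the preceding inequality: at \<open>x\<close>, the quadratic form of
  \<open>outer (M *v y)\<close> is the squared modulus of \<open>cinner y (M *v x)\<close>.\<close>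

lemma psd_cauchy_schwarz:
  assumes "psd M"
  shows "psd (Re (cinner y (M *v y)) *\<^sub>R M - outer (M *v y))"
proof (rule psdI)
  show "dagger (Re (cinner y (M *v y)) *\<^sub>R M - outer (M *v y))
      = Re (cinner y (M *v y)) *\<^sub>R M - outer (M *v y)"
    by (simp add: dagger_simps psd_dagger[OF assms])
  fix x
  have "cinner (M *v y) x = cinner y (M *v x)"
    using psd_dagger[OF assms] by (simp add: cinner_dagger[of y])
  then show "0 \<le> Re (cinner x ((Re (cinner y (M *v y)) *\<^sub>R M - outer (M *v y)) *v x))"
    using psd_cauchy_schwarz_vec[OF assms, of y x]
    by (simp add: matrix_vector_mult_diff_rdistrib cinner_diff_right cinner_outer
        matrix_vector_scaleR_left cinner_scaleR_right mult.commute)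
qed

section \<open>Traces of products of positive semidefinite operators\<close>

lemma Tr_add: "Tr (M + N) = Tr M + Tr N"
  by (simp add: Tr_def trace_add)

lemma Tr_diff: "Tr (M - N) = Tr M - Tr N"
  by (simp add: Tr_def trace_sub)

lemma Tr_scaleR: "Tr (c *\<^sub>R M) = c * Tr M"
  by (simp add: Tr_def trace_def sum_distrib_left)

lemma Tr_0: "Tr 0 = 0"
  by (simp add: Tr_def trace_def)

lemma Tr_sum: "Tr (sum M I) = (\<Sum>i\<in>I. Tr (M i))"
  by (induction I rule: infinite_finite_induct) (simp_all add: Tr_0 Tr_add)

lemmas Tr_simps = Tr_add Tr_diff Tr_scaleR

lemma Tr_outer_mult: "Tr (outer v ** M) = Re (cinner v (M *v v))"
proof -
  have "trace (outer v ** M) = (\<Sum>i\<in>UNIV. \<Sum>j\<in>UNIV. v $ i * cnj (v $ j) * M $ j $ i)"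
    by (simp add: trace_def matrix_matrix_mult_def outer_def)
  also have "\<dots> = (\<Sum>j\<in>UNIV. \<Sum>i\<in>UNIV. v $ i * cnj (v $ j) * M $ j $ i)"
    by (rule sum.swap)
  also have "\<dots> = cinner v (M *v v)"
    unfolding cinner_matrix by (intro sum.cong refl) (simp only: mult_ac)
  finally show ?thesis by (simp add: Tr_def)
qed

lemma Tr_commute: "Tr (M ** N) = Tr (N ** M)"
  unfolding Tr_def by (subst trace_mul_sym) (rule refl)

lemma psd_diag:
  assumes "psd M"
  shows "Im (M $ i $ i) = 0" "0 \<le> Re (M $ i $ i)"
proof -
  have "cinner (axis i 1) (M *v axis i 1) = M $ i $ i"
    by (simp add: cinner_axis matrix_vector_mult_axis_1)
  then have "M $ i $ i = of_real (Re (M $ i $ i))" "0 \<le> Re (M $ i $ i)"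
    using psd_of_real[OF assms, of "axis i 1"] psd_Re_nonneg[OF assms, of "axis i 1"] by simp_all
  then show "Im (M $ i $ i) = 0" "0 \<le> Re (M $ i $ i)"
    by (simp_all add: complex_eq_iff)
qed

text \<open>Schur complements: subtracting a suitable multiple of \<open>outer (M *v axis i 1)\<close> clears
  the \<open>i\<close>-th diagonal entry, so that \<open>M\<close> is reduced to a sum of rank one operators.\<close>

lemma Tr_mult_nonneg:
  assumes "psd M" "psd N"
  shows "0 \<le> Tr (M ** N)"
  using assms(1)
proof (induction "card {i. M $ i $ i \<noteq> 0}" arbitrary: M rule: less_induct)
  case (less M)
  have CS: "psd (Re (M $ i $ i) *\<^sub>R M - outer (M *v axis i 1))" for i
    using psd_cauchy_schwarz[OF less.prems, of "axis i 1"]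
    by (simp add: cinner_axis matrix_vector_mult_axis_1)
  show ?case
  proof (cases "\<exists>i. M $ i $ i \<noteq> 0")
    case False
    \<comment> \<open>For a zero diagonal entry, \<open>CS\<close> makes the negative of a rank one
      operator positive semidefinite, so the whole column is zero.\<close>
    have "M *v axis i 1 = 0" for i
      using CS[of i] False psd_neg_eq_0[OF psd_outer[of "M *v axis i 1"]]
      by (auto intro: outer_eq_0)
    then have "M $ j $ i = 0" for i j
      by (metis matrix_vector_mult_axis_1 zero_index)
    then have "M = 0" by (simp add: vec_eq_iff)
    then show ?thesis by (simp add: Tr_0)
  next
    case True
    then obtain i where i: "M $ i $ i \<noteq> 0" by auto
    define a where "a = Re (M $ i $ i)"
    have Mii: "M $ i $ i = of_real a" and a: "a > 0"
      using psd_diag[OF less.prems, of i] i by (auto simp: a_def complex_eq_iff)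
    define v where "v = M *v axis i 1"
    define M' where "M' = M - (1 / a) *\<^sub>R outer v"
    have "M' = (1 / a) *\<^sub>R (a *\<^sub>R M - outer v)"
      using a by (simp add: M'_def scaleR_diff_right)
    then have M': "psd M'"
      using CS[of i] a psd_scaleR[of "a *\<^sub>R M - outer v" "1 / a"] by (simp add: v_def a_def)
    have v: "v $ j = M $ j $ i" for j
      by (simp add: v_def matrix_vector_mult_axis_1)
    have M'_nth: "M' $ j $ j = M $ j $ j - of_real ((cmod (v $ j))\<^sup>2 / a)" for j
      by (simp add: M'_def outer_def complex_norm_square scaleR_conv_of_real[where 'a = complex]
        del: of_real_power)
    have "M' $ i $ i = 0"
      using a by (simp add: M'_nth v Mii power2_eq_square)
    \<comment> \<open>Diagonal entries only decrease and stay nonnegative, so zeros are preserved.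
      Together with the new zero at \<open>i\<close>, the induction measure drops strictly.\<close>
    moreover have "M' $ j $ j = 0" if "M $ j $ j = 0" for j
      using psd_diag[OF M', of j] a that by (simp add: M'_nth zero_le_divide_iff divide_le_0_iff)
    ultimately have "{j. M' $ j $ j \<noteq> 0} \<subset> {j. M $ j $ j \<noteq> 0}"
      using i by auto
    then have "0 \<le> Tr (M' ** N)"
      by (intro less.hyps M' psubset_card_mono) auto
    moreover have "Tr (M ** N) = Tr (M' ** N) + (1 / a) * Re (cinner v (N *v v))"
      by (simp add: M'_def matrix_mult_diff_right Tr_diff matrix_mult_scaleR_left Tr_scaleR
          Tr_outer_mult)
    ultimately show ?thesis
      using psd_Re_nonneg[OF assms(2), of v] a by simp
  qed
qed

lemma Tr_mult_mono:
  assumes "psd A" "psd (N - M)"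
  shows "Tr (A ** M) \<le> Tr (A ** N)"
  using Tr_mult_nonneg[OF assms] by (simp add: matrix_mult_diff_left Tr_diff)

lemma psd_Tr_nonneg: "psd M \<Longrightarrow> 0 \<le> Tr M"
  using Tr_mult_nonneg[OF _ psd_mat_1] by auto

text \<open>A one-dimensional row space gives entries \<open>z i * w $ j\<close>. Self-adjointness
  makes \<open>z\<close> proportional to the conjugate of \<open>w\<close>, and a positive diagonal
  entry makes the factor \<open>c\<close> nonnegative, so its square root can be absorbed into the
  vector.\<close>

lemma rank_one_psd:
  fixes B :: "complex ^ 'n ^ 'n"
  assumes "psd B" "rank B = 1"
  obtains v where "B = outer v" "v \<noteq> 0"
proof -
  have "vec.dim (rows B) = 1"
    using assms(2) by (simp add: row_rank_def_gen)
  then obtain S where S: "card S = 1" "rows B \<subseteq> vec.span S" "vec.independent S"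
    using vec.basis_exists[of "rows B"] by metis
  obtain w where w: "S = {w}"
    using S(1) by (auto simp: card_1_singleton_iff)
  have "\<exists>c. row i B = c *s w" for i
    using S(2) w by (auto simp: rows_def vec.span_singleton)
  then obtain z where "\<And>i. row i B = z i *s w" by metis
  then have B: "B $ i $ j = z i * w $ j" for i j
    by (simp add: row_def vec_eq_iff)
  have "w \<noteq> 0"
    using S(3) w vec.dependent_zero by blast
  then obtain k where k: "w $ k \<noteq> 0" by (auto simp: vec_eq_iff)
  define u where "u = (\<chi> i. cnj (w $ i))"
  define c where "c = cnj (z k) / w $ k"
  have "z i = c * u $ i" for i
  proof -
    have "dagger B $ i $ k = B $ i $ k" using psd_dagger[OF assms(1)] by simp
    then show ?thesis using k by (simp add: dagger_def B u_def c_def field_simps)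
  qed
  then have Bc: "B $ i $ j = c * (u $ i * cnj (u $ j))" for i j
    by (simp add: B u_def)
  have Bkk: "B $ k $ k = c * of_real ((cmod (u $ k))\<^sup>2)"
    by (simp only: Bc complex_norm_square)
  have "0 < (cmod (u $ k))\<^sup>2" using k by (simp add: u_def)
  then have c: "Im c = 0" "0 \<le> Re c"
    using psd_diag[OF assms(1), of k] unfolding Bkk by (auto simp: zero_le_mult_iff)
  then have "c = of_real (Re c)" by (simp add: complex_eq_iff)
  then have "B = outer (sqrt (Re c) *\<^sub>R u)"
    using c by (simp add: outer_scaleR vec_eq_iff Bc) (simp add: outer_def scaleR_conv_of_real)
  moreover have "B \<noteq> 0"
  proof
    assume "B = 0"
    then have "rows B \<subseteq> {0}" by (auto simp: rows_def row_def vec_eq_iff)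
    then have "vec.dim (rows B) = 0" by simp
    with assms(2) show False by (simp add: row_rank_def_gen)
  qed
  ultimately show ?thesis
    using that by (metis (no_types) outer_mult_vec matrix_eq vec.scale_zero_right matrix_vector_mult_0)
qed

section \<open>Tests and measurements\<close>

text \<open>Effects serve as two-outcome tests: \<open>T\<close> decides for the first operator and
  \<open>mat 1 - T\<close> for the second, so testing \<open>A\<close> against \<open>B\<close> has
  error \<open>Tr (A ** (mat 1 - T)) + Tr (B ** T)\<close>.\<close>

definition effect :: "complex ^ 'n ^ 'n \<Rightarrow> bool" where
  "effect T \<longleftrightarrow> psd T \<and> psd (mat 1 - T)"

text \<open>An operator above the identity has trivial kernel, hence an inverse \<open>R\<close>.
  The inverse is self-adjoint, and \<open>R = R ** M ** R\<close> is a congruence of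
  \<open>M\<close>.\<close>

lemma psd_inverse:
  assumes "psd M" "psd (M - mat 1)"
  obtains R where "psd R" "R ** M = mat 1" "M ** R = mat 1"
proof -
  have "x = 0" if "M *v x = 0" for x
  proof -
    have "0 \<le> Re (cinner x ((M - mat 1) *v x))" by (rule psd_Re_nonneg[OF assms(2)])
    then have "Re (cinner x x) \<le> 0"
      using that by (simp add: matrix_vector_mult_diff_rdistrib cinner_def sum_negf)
    moreover have "0 \<le> Re (cinner x x)"
      by (simp add: cinner_self sum_nonneg)
    ultimately have "cinner x x = 0"
      by (simp add: cinner_self)
    then show "x = 0" by (simp add: cinner_self_eq_0)
  qed
  then obtain R where RM: "R ** M = mat 1"
    using matrix_left_invertible_ker[of M] by auto
  then have MR: "M ** R = mat 1" by (simp add: matrix_left_right_inverse)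
  have "M ** dagger R = mat 1"
    using arg_cong[OF RM, of dagger] by (simp add: dagger_mult psd_dagger[OF assms(1)])
  then have "dagger R = R"
    by (metis RM matrix_mul_assoc matrix_mul_lid matrix_mul_rid)
  then have "psd (R ** M ** R)"
    by (intro psd_congruence_self assms)
  then have "psd R" by (simp add: RM)
  with RM MR show ?thesis using that by blast
qed

text \<open>With \<open>X\<close> and \<open>Z\<close> as in the header, the block operator with rows \<open>X, 1\<close> and \<open>1, Z\<close> is
  positive semidefinite; this replaces the inequality \<open>X\<^sup>-\<^sup>1 \<le> Z\<close> and avoids inverting \<open>X\<close>.\<close>

lemma effect_pair_form:
  assumes "effect T" "a > 0" "dagger C = C"
  shows "psd (a *\<^sub>R (mat 1 - T) + (1 / a) *\<^sub>R T - 2 *\<^sub>R C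
    + C ** ((1 / a) *\<^sub>R (mat 1 - T) + a *\<^sub>R T) ** C)"
proof -
  define U where "U = mat 1 - T"
  have T: "psd T" "psd U" using assms(1) by (simp_all add: effect_def U_def)
  have "psd ((1 / a) *\<^sub>R ((a *\<^sub>R mat 1 - C) ** U ** (a *\<^sub>R mat 1 - C))
      + a *\<^sub>R (((1 / a) *\<^sub>R mat 1 - C) ** T ** ((1 / a) *\<^sub>R mat 1 - C)))"
    using assms by (intro psd_add psd_scaleR psd_congruence_self T) (simp_all add: dagger_simps)
  also have "(1 / a) *\<^sub>R ((a *\<^sub>R mat 1 - C) ** U ** (a *\<^sub>R mat 1 - C))
      = a *\<^sub>R U - U ** C - C ** U + (1 / a) *\<^sub>R (C ** U ** C)"
    using assms(2) by (simp add: matrix_ring_simps algebra_simps)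
  also have "a *\<^sub>R (((1 / a) *\<^sub>R mat 1 - C) ** T ** ((1 / a) *\<^sub>R mat 1 - C))
      = (1 / a) *\<^sub>R T - T ** C - C ** T + a *\<^sub>R (C ** T ** C)"
    using assms(2) by (simp add: matrix_ring_simps algebra_simps)
  also have "a *\<^sub>R U - U ** C - C ** U + (1 / a) *\<^sub>R (C ** U ** C)
      + ((1 / a) *\<^sub>R T - T ** C - C ** T + a *\<^sub>R (C ** T ** C))
    = a *\<^sub>R U + (1 / a) *\<^sub>R T - 2 *\<^sub>R C + C ** ((1 / a) *\<^sub>R U + a *\<^sub>R T) ** C"
    by (simp add: U_def matrix_ring_simps algebra_simps scaleR_2)
  finally show ?thesis by (simp add: U_def)
qed

section \<open>Merging pairwise tests into one test\<close>

lemma combine_tests: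
  fixes A T :: "'i \<Rightarrow> complex ^ 'n ^ 'n"
  assumes fin: "finite I"
    and A: "\<And>i. i \<in> I \<Longrightarrow> psd (A i)" and B: "psd B"
    and T: "\<And>i. i \<in> I \<Longrightarrow> effect (T i)" and a: "\<And>i. i \<in> I \<Longrightarrow> a i > 0"
  obtains S where "effect S"
    "(\<Sum>i\<in>I. Tr (A i ** (mat 1 - S))) + Tr (B ** S)
      \<le> (\<Sum>i\<in>I. a i * (Tr (A i ** (mat 1 - T i)) + Tr (B ** T i)) + (Tr (A i) + Tr B) / a i) / 2"
proof -
  define X where "X i = a i *\<^sub>R (mat 1 - T i) + (1 / a i) *\<^sub>R T i" for i
  define Z where "Z i = (1 / a i) *\<^sub>R (mat 1 - T i) + a i *\<^sub>R T i" for i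
  define Y where "Y = sum Z I"
  define M where "M = mat 1 + Y ** Y"
  have T': "psd (T i)" "psd (mat 1 - T i)" if "i \<in> I" for i
    using T[OF that] by (simp_all add: effect_def)
  have Z: "psd (Z i)" if "i \<in> I" for i
    unfolding Z_def using T'[OF that] a[OF that] by (intro psd_add psd_scaleR) simp_all
  have Y: "psd Y" unfolding Y_def by (intro psd_sum Z)
  note dY = psd_dagger[OF Y]
  have YZ: "psd (Y - Z i)" if "i \<in> I" for i
  proof -
    have "Y - Z i = sum Z (I - {i})"
      unfolding Y_def using fin that by (simp add: sum.remove)
    then show ?thesis by (auto intro!: psd_sum Z)
  qed
  have psdYY: "psd (Y ** Y)" by (rule psd_square[OF dY])
  then have "psd M" "psd (M - mat 1)"
    by (auto simp: M_def intro: psd_add psd_mat_1)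
  then obtain R where R: "psd R" and RM: "R ** M = mat 1" and MR: "M ** R = mat 1"
    by (rule psd_inverse)
  note dR = psd_dagger[OF R]
  \<comment> \<open>\<open>matrix_ring_simps\<close> associates products to the left, so cancelling
    \<open>M ** R\<close> at the end of a longer product takes this form.\<close>
  have MR': "C ** M ** R = C" for C
    by (simp add: MR flip: matrix_mul_assoc)
  have YY: "Y ** Y = M - mat 1" by (simp add: M_def)

  have RX: "psd (X i - 2 *\<^sub>R R)" if i: "i \<in> I" for i
  proof -
    \<comment> \<open>Taking \<open>C = 2 R\<close> in \<open>effect_pair_form\<close> bounds
      \<open>X i\<close> below by \<open>4 R - 4 R Z R\<close> with \<open>Z = Z i\<close>. Here
      \<open>Z i\<close> may be enlarged to \<open>Y\<close>, and \<open>2 Y <= 1 + Y^2 = M\<close>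
      gives \<open>4 R Y R <= 2 R M R = 2 R\<close>. The three summands are the slacks of these
      three estimates.\<close>
    have "psd (X i - 2 *\<^sub>R (2 *\<^sub>R R) + (2 *\<^sub>R R) ** Z i ** (2 *\<^sub>R R)
        + 4 *\<^sub>R (R ** (Y - Z i) ** R) + 2 *\<^sub>R (R ** ((mat 1 - Y) ** (mat 1 - Y)) ** R))"
    proof (rule psd_add, rule psd_add)
      show "psd (X i - 2 *\<^sub>R (2 *\<^sub>R R) + (2 *\<^sub>R R) ** Z i ** (2 *\<^sub>R R))"
        unfolding X_def Z_def
        by (rule effect_pair_form) (use T[OF i] a[OF i] dR in \<open>simp_all add: dagger_simps\<close>)
      show "psd (4 *\<^sub>R (R ** (Y - Z i) ** R))"
        by (intro psd_scaleR psd_congruence_self YZ i dR) simp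
      show "psd (2 *\<^sub>R (R ** ((mat 1 - Y) ** (mat 1 - Y)) ** R))"
        by (intro psd_scaleR psd_congruence_self psd_square) (simp_all add: dagger_simps dR dY)
    qed
    also have "(mat 1 - Y) ** (mat 1 - Y) = M - 2 *\<^sub>R Y"
      by (simp add: matrix_ring_simps algebra_simps scaleR_2 YY)
    also have "R ** (M - 2 *\<^sub>R Y) ** R = R - 2 *\<^sub>R (R ** Y ** R)"
      by (simp add: matrix_ring_simps RM)
    also have "X i - 2 *\<^sub>R (2 *\<^sub>R R) + (2 *\<^sub>R R) ** Z i ** (2 *\<^sub>R R) + 4 *\<^sub>R (R ** (Y - Z i) ** R)
        + 2 *\<^sub>R (R - 2 *\<^sub>R (R ** Y ** R)) = X i - 2 *\<^sub>R R"
      by (simp add: matrix_ring_simps vec_eq_iff scaleR_conv_of_real[where 'a = complex] algebra_simps)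
    finally show ?thesis .
  qed
  have YR: "psd (Y - 2 *\<^sub>R (mat 1 - R))"
  proof -
    \<comment> \<open>In scalar terms, \<open>Y - 2 (1 - R) = Y (1 - Y)^2 R\<close>. Inserting
      \<open>1 = (1 + Y^2) R\<close> turns this into \<open>R (1 - Y) (Y + Y^3) (1 - Y) R\<close>,
      which is visibly a congruence of a positive operator.\<close>
    have "psd (Y + Y ** Y ** Y)"
      by (intro psd_add psd_congruence_self Y dY)
    then have "psd (R ** ((mat 1 - Y) ** (Y + Y ** Y ** Y) ** (mat 1 - Y)) ** R)"
      by (intro psd_congruence_self dR) (simp_all add: dagger_simps dY)
    also have "(mat 1 - Y) ** (Y + Y ** Y ** Y) ** (mat 1 - Y)
        = M ** Y ** M - 2 *\<^sub>R (M ** M) + 2 *\<^sub>R M"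
      unfolding M_def
      by (simp add: matrix_ring_simps vec_eq_iff scaleR_conv_of_real[where 'a = complex] algebra_simps)
    also have "R ** (M ** Y ** M - 2 *\<^sub>R (M ** M) + 2 *\<^sub>R M) ** R = Y - 2 *\<^sub>R (mat 1 - R)"
      by (simp add: matrix_ring_simps RM MR MR' scaleR_diff_right)
    finally show ?thesis .
  qed
  \<comment> \<open>From \<open>R M R = R\<close> it follows that \<open>R - R^2 = R Y^2 R\<close>,
    which exhibits \<open>1 - R\<close> as a sum of positive operators.\<close>
  have "psd ((mat 1 - R) ** (mat 1 - R) + R ** (Y ** Y) ** R)"
    by (intro psd_add psd_square psd_congruence_self psdYY dR) (simp add: dagger_simps dR)
  also have "(mat 1 - R) ** (mat 1 - R) + R ** (Y ** Y) ** R = mat 1 - R"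
    by (simp add: YY matrix_ring_simps RM)
  finally have S: "effect (mat 1 - R)"
    using R by (simp add: effect_def)
  have AR: "2 * Tr (A i ** R) \<le> a i * Tr (A i ** (mat 1 - T i)) + Tr (A i ** T i) / a i"
    if i: "i \<in> I" for i
    using Tr_mult_mono[OF A[OF i] RX[OF i]]
    by (simp add: X_def matrix_ring_simps Tr_simps)
  have "2 * Tr (B ** (mat 1 - R)) \<le> Tr (B ** Y)"
    using Tr_mult_mono[OF B YR] by (simp add: matrix_ring_simps Tr_simps)
  also have "Tr (B ** Y) = (\<Sum>i\<in>I. Tr (B ** Z i))"
    unfolding Y_def using fin
    by (induction I rule: finite_induct)
       (simp_all add: Tr_0 matrix_add_ldistrib Tr_add)
  finally have BR: "2 * Tr (B ** (mat 1 - R)) \<le> (\<Sum>i\<in>I. Tr (B ** Z i))" .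
  have "2 * ((\<Sum>i\<in>I. Tr (A i ** R)) + Tr (B ** (mat 1 - R)))
      \<le> (\<Sum>i\<in>I. a i * Tr (A i ** (mat 1 - T i)) + Tr (A i ** T i) / a i) + (\<Sum>i\<in>I. Tr (B ** Z i))"
    using add_mono[OF sum_mono[OF AR] BR] by (simp add: sum_distrib_left)
  also have "\<dots> = (\<Sum>i\<in>I. a i * Tr (A i ** (mat 1 - T i)) + Tr (A i ** T i) / a i + Tr (B ** Z i))"
    by (simp add: sum.distrib)
  also have "\<dots> \<le> (\<Sum>i\<in>I. a i * (Tr (A i ** (mat 1 - T i)) + Tr (B ** T i)) + (Tr (A i) + Tr B) / a i)"
  proof (rule sum_mono)
    fix i assume i: "i \<in> I"
    \<comment> \<open>The terms weighted by \<open>1 / a i\<close> belong to the correct decisions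
      of \<open>T i\<close>; they are bounded crudely by the full traces. The terms weighted by
      \<open>a i\<close> form the error of \<open>T i\<close>.\<close>
    have "0 \<le> Tr (A i ** (mat 1 - T i))" "0 \<le> Tr (B ** T i)"
      using A B T' i by (auto intro: Tr_mult_nonneg)
    then have "Tr (A i ** T i) / a i \<le> Tr (A i) / a i"
      and "Tr (B ** (mat 1 - T i)) / a i \<le> Tr B / a i"
      using a[OF i] by (auto intro!: divide_right_mono simp: matrix_mult_diff_left Tr_diff)
    moreover have "Tr (B ** Z i) = Tr (B ** (mat 1 - T i)) / a i + a i * Tr (B ** T i)"
      by (simp add: Z_def matrix_add_ldistrib matrix_mult_scaleR_right Tr_simps)
    ultimately show "a i * Tr (A i ** (mat 1 - T i)) + Tr (A i ** T i) / a i + Tr (B ** Z i)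
        \<le> a i * (Tr (A i ** (mat 1 - T i)) + Tr (B ** T i)) + (Tr (A i) + Tr B) / a i"
      by (simp add: distrib_left add_divide_distrib)
  qed
  finally show ?thesis
    using that[OF S] by simp
qed

section \<open>Pairwise errors and the error of an enlarged family\<close>

text \<open>An optimal POVM \<open>[T, U]\<close> may sum to less than the identity. Replacing
  \<open>U\<close> by the larger \<open>mat 1 - T\<close> does not increase the error.\<close>

lemma opt_error_pair_test:
  assumes "psd B"
  obtains T where "effect T" "Tr (A ** (mat 1 - T)) + Tr (B ** T) \<le> opt_error [A, B]"
proof -
  obtain E where E: "povm E" "length E = length [A, B]" "error_prob [A, B] E = opt_error [A, B]"
    using opt_error_attained by blast
  then obtain T U where TU: "E = [T, U]"
    by (auto simp: length_Suc_conv)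
  have "effect T"
    using E(1) povm_elem_le[OF E(1)] by (auto simp: TU povm_def effect_def)
  moreover have "Tr (B ** T) \<le> Tr (B ** (mat 1 - U))"
    using E(1) by (intro Tr_mult_mono assms) (simp add: TU povm_def algebra_simps)
  ultimately show ?thesis
    using that[of T] E(3) by (simp add: TU error_prob_def)
qed

lemma opt_error_pair_nonneg:
  assumes "psd A" "psd B"
  shows "0 \<le> opt_error [A, B]"
proof -
  obtain T where "effect T" "Tr (A ** (mat 1 - T)) + Tr (B ** T) \<le> opt_error [A, B]"
    using opt_error_pair_test[OF assms(2)] .
  moreover have "0 \<le> Tr (A ** (mat 1 - T))" "0 \<le> Tr (B ** T)"
    using \<open>effect T\<close> assms by (auto simp: effect_def intro: Tr_mult_nonneg)
  ultimately show ?thesis by linarith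
qed

lemma opt_error_snoc_le:
  assumes As: "\<And>A. A \<in> set As \<Longrightarrow> psd A" and B: "psd B" and S: "effect S"
  shows "opt_error (As @ [B])
    \<le> 2 * opt_error As + 3 * ((\<Sum>A\<leftarrow>As. Tr (A ** (mat 1 - S))) + Tr (B ** S))"
proof -
  obtain E where E: "povm E" "length E = length As" "error_prob As E = opt_error As"
    using opt_error_attained by blast
  define F where "F = map (\<lambda>M. S ** M ** S) E @ [mat 1 - S ** S]"
  have S': "psd S" "psd (mat 1 - S)" using S by (simp_all add: effect_def)
  note dS = psd_dagger[OF S'(1)]
  have psd_S_SS: "psd (S - S ** S)"
  proof -
    \<comment> \<open>The scalar identity \<open>s - s^2 = s (1 - s) s + (1 - s) s (1 - s)\<close>
      expresses the difference by congruences.\<close>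
    have "psd (S ** (mat 1 - S) ** S + (mat 1 - S) ** S ** (mat 1 - S))"
      by (intro psd_add psd_congruence_self S') (simp_all add: dagger_simps dS)
    also have "S ** (mat 1 - S) ** S + (mat 1 - S) ** S ** (mat 1 - S) = S - S ** S"
      by (simp add: matrix_ring_simps algebra_simps)
    finally show ?thesis .
  qed
  have "sum_list (map (\<lambda>M. S ** M ** S) E) = S ** sum_list E ** S"
    by (induction E) (simp_all add: matrix_ring_simps)
  then have "mat 1 - sum_list F = S ** (mat 1 - sum_list E) ** S"
    by (simp add: F_def matrix_ring_simps)
  moreover have "psd (S ** (mat 1 - sum_list E) ** S)"
    using E(1) by (intro psd_congruence_self dS) (simp add: povm_def)
  moreover have "psd (mat 1 - S ** S)"
    using psd_add[OF S'(2) psd_S_SS] by simp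
  ultimately have "povm F"
    using E(1) by (auto simp: povm_def F_def intro: psd_congruence_self dS)
  then have "opt_error (As @ [B]) \<le> error_prob (As @ [B]) F"
    by (rule opt_error_le) (simp add: F_def E(2))
  also have "\<dots> = (\<Sum>i<length As. Tr (As ! i ** (mat 1 - S ** E ! i ** S))) + Tr (B ** (S ** S))"
    by (simp add: error_prob_def F_def nth_append E(2))
  also have "\<dots> \<le> (\<Sum>i<length As. 2 * Tr (As ! i ** (mat 1 - E ! i)) + 3 * Tr (As ! i ** (mat 1 - S)))
      + 3 * Tr (B ** S)"
  proof (intro add_mono sum_mono)
    fix i assume "i \<in> {..<length As}"
    then have i: "As ! i \<in> set As" "E ! i \<in> set E" using E(2) by auto
    have Ei: "psd (E ! i)" "psd (mat 1 - E ! i)"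
      using E(1) i(2) povm_elem_le[OF E(1)] by (auto simp: povm_def)
    \<comment> \<open>A certificate for \<open>1 - S E S <= 2 (1 - E) + 3 (1 - S)\<close>: the mixed
      terms \<open>S E\<close> and \<open>E S\<close> cancel between the first two summands, and
      \<open>S - S^2\<close> removes the remaining square of \<open>S\<close>.\<close>
    have "psd ((2 *\<^sub>R mat 1 - S) ** (mat 1 - E ! i) ** (2 *\<^sub>R mat 1 - S)
        + 2 *\<^sub>R ((mat 1 - S) ** E ! i ** (mat 1 - S)) + (S - S ** S))"
      by (intro psd_add psd_scaleR psd_congruence_self psd_S_SS Ei)
         (simp_all add: dagger_simps dS)
    also have "(2 *\<^sub>R mat 1 - S) ** (mat 1 - E ! i) ** (2 *\<^sub>R mat 1 - S)
        + 2 *\<^sub>R ((mat 1 - S) ** E ! i ** (mat 1 - S)) + (S - S ** S)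
      = (2 *\<^sub>R (mat 1 - E ! i) + 3 *\<^sub>R (mat 1 - S)) - (mat 1 - S ** E ! i ** S)"
      by (simp add: matrix_ring_simps vec_eq_iff scaleR_conv_of_real[where 'a = complex] algebra_simps)
    finally have "Tr (As ! i ** (mat 1 - S ** E ! i ** S))
        \<le> Tr (As ! i ** (2 *\<^sub>R (mat 1 - E ! i) + 3 *\<^sub>R (mat 1 - S)))"
      by (rule Tr_mult_mono[OF As[OF i(1)]])
    then show "Tr (As ! i ** (mat 1 - S ** E ! i ** S))
        \<le> 2 * Tr (As ! i ** (mat 1 - E ! i)) + 3 * Tr (As ! i ** (mat 1 - S))"
      by (simp add: matrix_add_ldistrib matrix_mult_scaleR_right Tr_simps)
  next
    have "Tr (B ** (S ** S)) \<le> Tr (B ** S)" by (rule Tr_mult_mono[OF B psd_S_SS])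
    also have "\<dots> \<le> 3 * Tr (B ** S)" using Tr_mult_nonneg[OF B S'(1)] by simp
    finally show "Tr (B ** (S ** S)) \<le> 3 * Tr (B ** S)" .
  qed
  also have "\<dots> = 2 * opt_error As + 3 * ((\<Sum>A\<leftarrow>As. Tr (A ** (mat 1 - S))) + Tr (B ** S))"
    unfolding E(3)[symmetric] error_prob_def
    by (simp add: sum.distrib sum_distrib_left sum_list_sum_nth atLeast0LessThan distrib_left)
  finally show ?thesis .
qed

text \<open>The minimizer of \<open>a * p + t / a\<close> is \<open>sqrt (t / p)\<close>. For
  \<open>p = 0\<close> and \<open>t > 0\<close> the infimum is not attained, so a large
  \<open>a\<close> is chosen at the cost of \<open>\<epsilon>\<close>.\<close>

lemma exists_balancing_factor:
  fixes p t \<epsilon> :: real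
  assumes "0 \<le> p" "0 \<le> t" "p > 0 \<Longrightarrow> t > 0" "\<epsilon> > 0"
  shows "\<exists>a>0. (a * p + t / a) / 2 \<le> sqrt (t * p) + \<epsilon>"
proof (cases "p = 0")
  case True
  define a where "a = t / \<epsilon> + 1"
  have a: "a > 0" using assms by (simp add: a_def add_nonneg_pos)
  have "t = \<epsilon> * (a - 1)" using assms(4) by (simp add: a_def)
  also have "\<dots> \<le> 2 * \<epsilon> * a" using assms(4) a by (simp add: algebra_simps)
  finally have "t / a / 2 \<le> \<epsilon>" using a by (simp add: pos_divide_le_eq)
  then have "(a * p + t / a) / 2 \<le> sqrt (t * p) + \<epsilon>"
    using True by simp
  with a show ?thesis by blast
next
  case False
  with assms have pt: "p > 0" "t > 0" by auto
  have "sqrt (t / p) * p = sqrt (t * p)" "t / sqrt (t / p) = sqrt (t * p)"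
    using pt by (simp_all add: real_sqrt_divide real_sqrt_mult field_simps)
  then show ?thesis
    using pt assms(4) by (intro exI[of _ "sqrt (t / p)"]) simp
qed

lemma combine_pair_tests:
  fixes A :: "'i \<Rightarrow> complex ^ 'n ^ 'n"
  assumes fin: "finite I" and A: "\<And>i. i \<in> I \<Longrightarrow> psd (A i)" and B: "psd B" and "\<epsilon> > 0"
  obtains S where "effect S"
    "(\<Sum>i\<in>I. Tr (A i ** (mat 1 - S))) + Tr (B ** S)
      \<le> (\<Sum>i\<in>I. sqrt (Tr (A i) + Tr B) * sqrt (opt_error [A i, B])) + \<epsilon>"
proof -
  \<comment> \<open>Each index may waste \<open>\<delta>\<close>; the added 1 avoids division by
    zero when \<open>I\<close> is empty.\<close>
  define \<delta> where "\<delta> = \<epsilon> / (real (card I) + 1)"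
  have \<delta>: "\<delta> > 0" "card I * \<delta> \<le> \<epsilon>"
    using \<open>\<epsilon> > 0\<close> by (simp_all add: \<delta>_def field_simps)
  define err where "err i U = Tr (A i ** (mat 1 - U)) + Tr (B ** U)" for i U
  have "\<exists>T. effect T \<and> err i T \<le> opt_error [A i, B]" for i
    using opt_error_pair_test[OF B, of "A i"] unfolding err_def by blast
  then have "\<exists>T. \<forall>i. effect (T i) \<and> err i (T i) \<le> opt_error [A i, B]"
    by (intro choice allI)
  then obtain T where T: "\<And>i. effect (T i)" "\<And>i. err i (T i) \<le> opt_error [A i, B]"
    by blast
  have "\<exists>a>0. (a * err i (T i) + (Tr (A i) + Tr B) / a) / 2
      \<le> sqrt ((Tr (A i) + Tr B) * err i (T i)) + \<delta>" if i: "i \<in> I" for i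
  proof (rule exists_balancing_factor)
    have T': "psd (T i)" "psd (mat 1 - T i)" using T(1)[of i] by (simp_all add: effect_def)
    \<comment> \<open>The total trace is the error plus the last two quantities, so it is positive
      whenever the error is.\<close>
    have "0 \<le> Tr (A i ** (mat 1 - T i))" "0 \<le> Tr (B ** T i)"
      "0 \<le> Tr (A i ** T i)" "0 \<le> Tr (B ** (mat 1 - T i))"
      by (intro Tr_mult_nonneg A[OF i] B T')+
    then show "0 \<le> err i (T i)" "0 \<le> Tr (A i) + Tr B"
        "0 < err i (T i) \<Longrightarrow> 0 < Tr (A i) + Tr B"
      by (auto simp: err_def matrix_mult_diff_left Tr_diff)
  qed (rule \<delta>)
  then have "\<forall>i\<in>I. \<exists>a. a > 0 \<and> (a * err i (T i) + (Tr (A i) + Tr B) / a) / 2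
      \<le> sqrt ((Tr (A i) + Tr B) * err i (T i)) + \<delta>"
    by blast
  from bchoice[OF this] obtain a where a: "\<And>i. i \<in> I \<Longrightarrow> a i > 0"
    "\<And>i. i \<in> I \<Longrightarrow> (a i * err i (T i) + (Tr (A i) + Tr B) / a i) / 2
      \<le> sqrt ((Tr (A i) + Tr B) * err i (T i)) + \<delta>"
    by blast
  obtain S where S: "effect S" "(\<Sum>i\<in>I. Tr (A i ** (mat 1 - S))) + Tr (B ** S)
      \<le> (\<Sum>i\<in>I. a i * err i (T i) + (Tr (A i) + Tr B) / a i) / 2"
    using combine_tests[OF fin A B T(1) a(1)] unfolding err_def .
  note S(2)
  also have "(\<Sum>i\<in>I. a i * err i (T i) + (Tr (A i) + Tr B) / a i) / 2
      = (\<Sum>i\<in>I. (a i * err i (T i) + (Tr (A i) + Tr B) / a i) / 2)"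
    by (rule sum_divide_distrib)
  also have "\<dots> \<le> (\<Sum>i\<in>I. sqrt (Tr (A i) + Tr B) * sqrt (opt_error [A i, B]) + \<delta>)"
  proof (rule sum_mono)
    fix i assume i: "i \<in> I"
    have "sqrt ((Tr (A i) + Tr B) * err i (T i)) \<le> sqrt ((Tr (A i) + Tr B) * opt_error [A i, B])"
      using psd_Tr_nonneg[OF A[OF i]] psd_Tr_nonneg[OF B] T(2)[of i]
      by (simp add: mult_left_mono)
    with a(2)[OF i] show "(a i * err i (T i) + (Tr (A i) + Tr B) / a i) / 2
        \<le> sqrt (Tr (A i) + Tr B) * sqrt (opt_error [A i, B]) + \<delta>"
      by (simp add: real_sqrt_mult)
  qed
  also have "\<dots> \<le> (\<Sum>i\<in>I. sqrt (Tr (A i) + Tr B) * sqrt (opt_error [A i, B])) + \<epsilon>"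
    using \<delta>(2) by (simp add: sum.distrib)
  finally show ?thesis using that[OF S(1)] by simp
qed

section \<open>Sharper estimates for rank one operators\<close>

text \<open>Write \<open>x = u + v\<close> with \<open>u = T x\<close> and
  \<open>v = (1 - T) x\<close>. Positivity of \<open>outer (s u - v)\<close> gives
  \<open>outer x <= (1 + s) outer u + (1 + 1/s) outer v\<close>, and Cauchy-Schwarz bounds
  \<open>outer u\<close> and \<open>outer v\<close> by multiples of \<open>T\<close> and
  \<open>1 - T\<close>.\<close>

lemma outer_le_effect:
  assumes T: "effect T" and s: "s > 0"
  shows "psd (((1 + s) * Re (cinner x (T *v x))) *\<^sub>R T
    + ((1 + 1 / s) * Re (cinner x ((mat 1 - T) *v x))) *\<^sub>R (mat 1 - T) - outer x)"
proof -
  define U where "U = mat 1 - T"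
  define b c where "b = Re (cinner x (T *v x))" and "c = Re (cinner x (U *v x))"
  define u v where "u = T *v x" and "v = U *v x"
  have "psd T" "psd U" using T by (simp_all add: effect_def U_def)
  then have CS: "psd (b *\<^sub>R T - outer u)" "psd (c *\<^sub>R U - outer v)"
    unfolding b_def c_def u_def v_def by (simp_all add: psd_cauchy_schwarz)
  have x: "x = u + v"
    by (simp add: u_def v_def U_def matrix_vector_mult_diff_rdistrib)
  have sq: "complex_of_real (sqrt s) * complex_of_real (sqrt s) = of_real s"
    using s by (simp flip: of_real_mult)
  have "psd ((1 / s) *\<^sub>R outer (s *\<^sub>R u - v))"
    using s by (intro psd_scaleR psd_outer) simp
  also have "(1 / s) *\<^sub>R outer (s *\<^sub>R u - v)
      = (1 + s) *\<^sub>R outer u + (1 + 1 / s) *\<^sub>R outer v - outer x"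
    using s by (simp add: x outer_def vec_eq_iff scaleR_conv_of_real[where 'a = complex] field_simps)
  finally have "psd ((1 + s) *\<^sub>R (b *\<^sub>R T - outer u) + (1 + 1 / s) *\<^sub>R (c *\<^sub>R U - outer v)
      + ((1 + s) *\<^sub>R outer u + (1 + 1 / s) *\<^sub>R outer v - outer x))"
    using s by (intro psd_add psd_scaleR CS; simp)
  then show ?thesis
    unfolding U_def[symmetric] b_def[symmetric] c_def[symmetric]
    by (simp add: algebra_simps)
qed

text \<open>Tracing \<open>outer_le_effect\<close> against \<open>A\<close> gives a bound for every
  \<open>s > 0\<close>. At \<open>s = \<alpha>' / \<beta>\<close> it factors as
  \<open>(\<alpha> + \<beta>') * (\<alpha>' + \<beta>)\<close>: the second factor is the error of
  \<open>T\<close>, and the first is at most the total trace.\<close>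

lemma fidelity_le_opt_error:
  assumes A: "psd A"
  shows "Re (cinner x (A *v x)) \<le> (Tr A + Tr (outer x)) * opt_error [A, outer x]"
proof -
  obtain T where T: "effect T" "Tr (A ** (mat 1 - T)) + Tr (outer x ** T) \<le> opt_error [A, outer x]"
    using opt_error_pair_test[OF psd_outer] .
  have T': "psd T" "psd (mat 1 - T)" using T(1) by (simp_all add: effect_def)
  define \<alpha> \<alpha>' \<beta> \<beta>' where "\<alpha> = Tr (A ** T)" and "\<alpha>' = Tr (A ** (mat 1 - T))"
    and "\<beta> = Tr (outer x ** T)" and "\<beta>' = Tr (outer x ** (mat 1 - T))"
  have nn: "0 \<le> \<alpha>" "0 \<le> \<alpha>'" "0 \<le> \<beta>" "0 \<le> \<beta>'"
    unfolding \<alpha>_def \<alpha>'_def \<beta>_def \<beta>'_def by (intro Tr_mult_nonneg A psd_outer T')+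
  have t: "Tr A + Tr (outer x) = (\<alpha> + \<beta>') + (\<alpha>' + \<beta>)"
    by (simp add: \<alpha>_def \<alpha>'_def \<beta>_def \<beta>'_def matrix_mult_diff_left Tr_diff)
  have bound: "Re (cinner x (A *v x)) \<le> (1 + s) * \<beta> * \<alpha> + (1 + 1 / s) * \<beta>' * \<alpha>'" if "s > 0" for s
    using Tr_mult_mono[OF A outer_le_effect[OF T(1) that, of x]]
    by (simp add: Tr_commute[of A "outer x"] Tr_outer_mult matrix_add_ldistrib Tr_add
        matrix_mult_scaleR_right Tr_scaleR \<alpha>_def \<alpha>'_def \<beta>_def \<beta>'_def)
  have "Re (cinner x (A *v x)) \<le> (\<alpha> + \<beta>') * (\<alpha>' + \<beta>) + e" if "e > 0" for e
  proof -
    \<comment> \<open>Numerator and denominator of \<open>\<alpha>' / \<beta>\<close> may vanish, so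
      both are shifted by \<open>d\<close>, which is small enough for the excess
      \<open>d * (\<alpha> + \<beta>')\<close> to stay below \<open>e\<close>.\<close>
    define d where "d = e / (\<alpha> + \<beta>' + 1)"
    have d: "d > 0" "d * (\<alpha> + \<beta>') \<le> e"
      using nn that by (simp_all add: d_def field_simps add_nonneg_pos)
    define s where "s = (\<alpha>' + d) / (\<beta> + d)"
    have s: "s > 0" using nn d by (simp add: s_def add_nonneg_pos)
    have *: "s * \<beta> \<le> \<alpha>' + d" "1 / s * \<alpha>' \<le> \<beta> + d"
      using nn d by (simp_all add: s_def field_simps add_nonneg_pos)
    have "s * \<beta> * \<alpha> \<le> (\<alpha>' + d) * \<alpha>" "1 / s * \<alpha>' * \<beta>' \<le> (\<beta> + d) * \<beta>'"
      using *[THEN mult_right_mono] nn by blast+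
    with bound[OF s] d(2) show ?thesis by (simp add: algebra_simps)
  qed
  then have "Re (cinner x (A *v x)) \<le> (\<alpha> + \<beta>') * (\<alpha>' + \<beta>)"
    by (rule field_le_epsilon)
  also have "\<dots> \<le> (Tr A + Tr (outer x)) * opt_error [A, outer x]"
    using T(2) nn unfolding t by (intro mult_mono) (auto simp: \<alpha>'_def \<beta>_def)
  finally show ?thesis .
qed

text \<open>Dividing \<open>outer x\<close> by its trace gives the orthogonal projection onto the
  line of \<open>x\<close>. The test is the complementary projection, which annihilates
  \<open>x\<close> and so makes no error on \<open>outer x\<close>.\<close>

lemma rank_one_test:
  fixes x :: "complex ^ 'n"
  assumes "x \<noteq> 0"
  defines "b \<equiv> Tr (outer x)"
  shows "b > 0" "effect (mat 1 - (1 / b) *\<^sub>R outer x)"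
    "Tr (outer x ** (mat 1 - (1 / b) *\<^sub>R outer x)) = 0"
proof -
  have b: "b = Re (cinner x x)"
    unfolding b_def using Tr_outer_mult[of x "mat 1"] by simp
  moreover have "cinner x x = of_real (Re (cinner x x))"
    by (simp add: cinner_self)
  ultimately have "b \<noteq> 0"
    using assms(1) cinner_self_eq_0[of x] by auto
  moreover have "0 \<le> b"
    unfolding b_def by (rule psd_Tr_nonneg[OF psd_outer])
  ultimately show "b > 0" by simp
  define P where "P = (1 / b) *\<^sub>R outer x"
  have P: "psd P" unfolding P_def using \<open>b > 0\<close> by (intro psd_scaleR psd_outer) simp
  have PP: "P ** P = P"
    using \<open>b > 0\<close> by (simp add: P_def matrix_ring_simps outer_square flip: b)
  then have "(mat 1 - P) ** (mat 1 - P) = mat 1 - P"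
    by (simp add: matrix_ring_simps)
  then have "psd (mat 1 - P)"
    using psd_square[of "mat 1 - P"] by (simp add: dagger_simps psd_dagger[OF P])
  with P show "effect (mat 1 - (1 / b) *\<^sub>R outer x)" by (simp add: effect_def P_def)
  show "Tr (outer x ** (mat 1 - (1 / b) *\<^sub>R outer x)) = 0"
    using \<open>b > 0\<close> by (simp add: matrix_ring_simps outer_square Tr_0 flip: b)
qed

section \<open>Adding one operator at a time\<close>

lemma map_upt_Suc_snoc: "k \<ge> 1 \<Longrightarrow> map A [1..<Suc k + 1] = map A [1..<k + 1] @ [A (Suc k)]"
  by simp

lemma sum_list_map_upt: "(\<Sum>B\<leftarrow>map A [1..<k + 1]. f B) = (\<Sum>l = 1..k. f (A l))"
  by (simp only: map_map o_def interv_sum_list_conv_sum_set_nat set_upt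
      Suc_eq_plus1[symmetric] atLeastLessThanSuc_atLeastAtMost)

lemma opt_error_Suc_le_effect:
  assumes psd: "\<And>i. 1 \<le> i \<Longrightarrow> i \<le> Suc k \<Longrightarrow> psd (A i)" and "effect S" and "k \<ge> 1"
  shows "opt_error (map A [1..<Suc k + 1]) \<le> 2 * opt_error (map A [1..<k + 1])
      + 3 * ((\<Sum>l = 1..k. Tr (A l ** (mat 1 - S))) + Tr (A (Suc k) ** S))"
proof -
  have "opt_error (map A [1..<k + 1] @ [A (Suc k)]) \<le> 2 * opt_error (map A [1..<k + 1])
      + 3 * ((\<Sum>B\<leftarrow>map A [1..<k + 1]. Tr (B ** (mat 1 - S))) + Tr (A (Suc k) ** S))"
    by (rule opt_error_snoc_le) (use assms in auto)
  then show ?thesis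
    unfolding map_upt_Suc_snoc[OF \<open>k \<ge> 1\<close>] sum_list_map_upt .
qed

lemma opt_error_Suc_le:
  assumes psd: "\<And>i. 1 \<le> i \<Longrightarrow> i \<le> Suc k \<Longrightarrow> psd (A i)" and "k \<ge> 1"
  shows "opt_error (map A [1..<Suc k + 1]) \<le> 2 * opt_error (map A [1..<k + 1])
    + 3 * (\<Sum>l = 1..k. sqrt (Tr (A l) + Tr (A (Suc k))) * sqrt (opt_error [A l, A (Suc k)]))"
proof (rule field_le_epsilon)
  \<comment> \<open>The merged test is taken with accuracy \<open>e / 3\<close>, since its error
    enters with the factor 3.\<close>
  fix e :: real assume "e > 0"
  then obtain S where S: "effect S"
    "(\<Sum>l\<in>{1..k}. Tr (A l ** (mat 1 - S))) + Tr (A (Suc k) ** S)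
      \<le> (\<Sum>l\<in>{1..k}. sqrt (Tr (A l) + Tr (A (Suc k))) * sqrt (opt_error [A l, A (Suc k)])) + e / 3"
    using combine_pair_tests[of "{1..k}" A "A (Suc k)" "e / 3"] psd by auto
  have "opt_error (map A [1..<Suc k + 1]) \<le> 2 * opt_error (map A [1..<k + 1])
      + 3 * ((\<Sum>l = 1..k. Tr (A l ** (mat 1 - S))) + Tr (A (Suc k) ** S))"
    by (rule opt_error_Suc_le_effect[OF psd S(1) \<open>k \<ge> 1\<close>])
  with S(2) show "opt_error (map A [1..<Suc k + 1]) \<le> 2 * opt_error (map A [1..<k + 1])
      + 3 * (\<Sum>l = 1..k. sqrt (Tr (A l) + Tr (A (Suc k))) * sqrt (opt_error [A l, A (Suc k)])) + e"
    by simp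
qed

text \<open>Under the complementary projection only the earlier operators contribute, each with
  \<open>Re (cinner x (A l *v x)) / b\<close>, and \<open>fidelity_le_opt_error\<close> applies.
  Positivity of the trace is recorded because it later makes the minimum in the constant
  positive.\<close>

lemma opt_error_Suc_le_rank_one:
  assumes psd: "\<And>i. 1 \<le> i \<Longrightarrow> i \<le> Suc k \<Longrightarrow> psd (A i)" and "k \<ge> 1" and "rank (A (Suc k)) = 1"
  shows "Tr (A (Suc k)) > 0"
    "opt_error (map A [1..<Suc k + 1]) \<le> 2 * opt_error (map A [1..<k + 1])
      + 3 * (\<Sum>l = 1..k. (Tr (A l) + Tr (A (Suc k))) / Tr (A (Suc k)) * opt_error [A l, A (Suc k)])"
proof -
  obtain x where x: "A (Suc k) = outer x" "x \<noteq> 0"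
    using rank_one_psd[OF psd assms(3)] by auto
  define b where "b = Tr (outer x)"
  define S where "S = mat 1 - (1 / b) *\<^sub>R outer x"
  have b: "b > 0" and S: "effect S" "Tr (outer x ** S) = 0"
    using rank_one_test[OF x(2)] unfolding b_def S_def by simp_all
  show "Tr (A (Suc k)) > 0" using b by (simp add: x b_def)
  have "opt_error (map A [1..<Suc k + 1]) \<le> 2 * opt_error (map A [1..<k + 1])
      + 3 * ((\<Sum>l = 1..k. Tr (A l ** (mat 1 - S))) + Tr (A (Suc k) ** S))"
    by (rule opt_error_Suc_le_effect[OF psd S(1) \<open>k \<ge> 1\<close>])
  also have "\<dots> = 2 * opt_error (map A [1..<k + 1]) + 3 * (\<Sum>l = 1..k. Re (cinner x (A l *v x)) / b)"
    unfolding x(1) S(2)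
    by (simp add: S_def matrix_mult_scaleR_right Tr_scaleR Tr_commute[of _ "outer x"] Tr_outer_mult)
  also have "\<dots> \<le> 2 * opt_error (map A [1..<k + 1])
      + 3 * (\<Sum>l = 1..k. (Tr (A l) + b) / b * opt_error [A l, outer x])"
  proof (rule add_left_mono, rule mult_left_mono, rule sum_mono)
    fix l assume "l \<in> {1..k}"
    then have "Re (cinner x (A l *v x)) \<le> (Tr (A l) + b) * opt_error [A l, outer x]"
      unfolding b_def using psd by (intro fidelity_le_opt_error) auto
    then show "Re (cinner x (A l *v x)) / b \<le> (Tr (A l) + b) / b * opt_error [A l, outer x]"
      using b by (simp add: field_simps)
  qed simp
  finally show "opt_error (map A [1..<Suc k + 1]) \<le> 2 * opt_error (map A [1..<k + 1])
      + 3 * (\<Sum>l = 1..k. (Tr (A l) + Tr (A (Suc k))) / Tr (A (Suc k)) * opt_error [A l, A (Suc k)])"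
    by (simp add: x b_def)
qed

text \<open>The increment \<open>c * g k\<close> enters at \<open>f (Suc k)\<close> and is then
  doubled in each of the remaining \<open>r - 1 - k\<close> steps.\<close>

lemma doubling_recurrence:
  fixes f g :: "nat \<Rightarrow> real"
  assumes "\<And>k. 2 \<le> k \<Longrightarrow> k < r \<Longrightarrow> f (Suc k) \<le> 2 * f k + c * g k" and "2 \<le> r"
  shows "f r \<le> 2 ^ (r - 2) * f 2 + c * (\<Sum>k = 2..r - 1. 2 ^ (r - 1 - k) * g k)"
  using assms(2,1)
proof (induction r rule: dec_induct)
  case base
  then show ?case by simp
next
  case (step n)
  have "f (Suc n) \<le> 2 * f n + c * g n"
    using step by simp
  also have "\<dots> \<le> 2 * (2 ^ (n - 2) * f 2 + c * (\<Sum>k = 2..n - 1. 2 ^ (n - 1 - k) * g k)) + c * g n"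
    using step by simp
  also have "\<dots> = 2 * 2 ^ (n - 2) * f 2
      + c * ((\<Sum>k = 2..n - 1. 2 * 2 ^ (n - 1 - k) * g k) + g n)"
    by (simp add: algebra_simps sum_distrib_left)
  also have "2 * 2 ^ (n - 2) = (2 :: real) ^ (Suc n - 2)"
    using step(1) by (simp add: Suc_diff_le numeral_2_eq_2 flip: power_Suc)
  also have "(\<Sum>k = 2..n - 1. 2 * 2 ^ (n - 1 - k) * g k) = (\<Sum>k = 2..n - 1. 2 ^ (n - k) * g k)"
  proof (rule sum.cong[OF refl])
    fix k assume "k \<in> {2..n - 1}"
    then have "n - k = Suc (n - 1 - k)" by auto
    then show "2 * 2 ^ (n - 1 - k) * g k = 2 ^ (n - k) * g k" by simp
  qed
  \<comment> \<open>The new increment is the summand \<open>k = n\<close>, of weight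
    \<open>2 ^ 0\<close>; the upper end \<open>n\<close> appears as
    \<open>Suc (n - 1)\<close>.\<close>
  also have "(\<Sum>k = 2..n - 1. 2 ^ (n - k) * g k) + g n = (\<Sum>k = 2..Suc (n - 1). 2 ^ (n - k) * g k)"
    using step(1) by (subst sum.cl_ivl_Suc) auto
  finally show ?case using step(1) by simp
qed

theorem theorem6p5:
  fixes A :: "nat \<Rightarrow> complex ^ 'n ^ 'n" and r :: nat and \<kappa> \<kappa>' :: real
  assumes "r \<ge> 2"
    and "\<forall>i\<in>{1..r}. psd (A i)"
    and "\<kappa> = 3 * Max {sqrt (Tr (A i) + Tr (A j)) | i j. 1 \<le> i \<and> i < j \<and> j \<le> r}"
    and "\<kappa>' = 3 * Tr (\<Sum>i = 1..r. A i) / Min {Tr (A i) | i. 3 \<le> i \<and> i \<le> r}"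
  shows "opt_error (map A [1..<r + 1])
      \<le> 2 ^ (r - 2) * opt_error [A 1, A 2]
        + \<kappa> * (\<Sum>k = 2..r - 1. 2 ^ (r - 1 - k) * (\<Sum>l = 1..k. sqrt (opt_error [A l, A (k + 1)])))
    \<and> ((\<forall>k\<in>{3..r}. rank (A k) = 1) \<longrightarrow>
      opt_error (map A [1..<r + 1])
      \<le> 2 ^ (r - 2) * opt_error [A 1, A 2]
        + \<kappa>' * (\<Sum>k = 2..r - 1. 2 ^ (r - 1 - k) * (\<Sum>l = 1..k. opt_error [A l, A (k + 1)])))"
proof -
  define f where "f k = opt_error (map A [1..<k + 1])" for k
  have f2: "f 2 = opt_error [A 1, A 2]"
    by (simp add: f_def upt_rec numeral_2_eq_2)
  have psd: "psd (A i)" if "1 \<le> i" "i \<le> r" for i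
    using assms(2) that by simp
  have nonneg: "0 \<le> opt_error [A l, A (k + 1)]" if "l \<in> {1..k}" "k < r" for l k
    using that by (intro opt_error_pair_nonneg psd) auto

  have general: "f r \<le> 2 ^ (r - 2) * f 2
      + \<kappa> * (\<Sum>k = 2..r - 1. 2 ^ (r - 1 - k) * (\<Sum>l = 1..k. sqrt (opt_error [A l, A (k + 1)])))"
  proof (rule doubling_recurrence[OF _ assms(1)])
    fix k assume k: "2 \<le> k" "k < r"
    let ?M = "{sqrt (Tr (A i) + Tr (A j)) | i j. 1 \<le> i \<and> i < j \<and> j \<le> r}"
    have "?M \<subseteq> (\<lambda>(i, j). sqrt (Tr (A i) + Tr (A j))) ` ({1..r} \<times> {1..r})"
      by force
    then have "finite ?M" by (rule finite_subset) simp
    moreover have "sqrt (Tr (A l) + Tr (A (Suc k))) \<in> ?M" if "l \<in> {1..k}" for l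
    proof -
      have "1 \<le> l" "l < Suc k" "Suc k \<le> r" using that k by auto
      then show ?thesis by blast
    qed
    ultimately have max: "3 * sqrt (Tr (A l) + Tr (A (Suc k))) \<le> \<kappa>" if "l \<in> {1..k}" for l
      unfolding assms(3) using that by (intro mult_left_mono Max_ge) auto
    have "f (Suc k) \<le> 2 * f k
        + 3 * (\<Sum>l = 1..k. sqrt (Tr (A l) + Tr (A (Suc k))) * sqrt (opt_error [A l, A (Suc k)]))"
      unfolding f_def using k by (intro opt_error_Suc_le psd) auto
    also have "\<dots> \<le> 2 * f k + \<kappa> * (\<Sum>l = 1..k. sqrt (opt_error [A l, A (k + 1)]))"
      unfolding sum_distrib_left
    proof (intro add_left_mono sum_mono)
      fix l assume l: "l \<in> {1..k}"
      show "3 * (sqrt (Tr (A l) + Tr (A (Suc k))) * sqrt (opt_error [A l, A (Suc k)]))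
          \<le> \<kappa> * sqrt (opt_error [A l, A (k + 1)])"
        using mult_right_mono[OF max[OF l], of "sqrt (opt_error [A l, A (k + 1)])"]
          nonneg[OF l k(2)] by (simp add: mult.assoc)
    qed
    finally show "f (Suc k) \<le> 2 * f k + \<kappa> * (\<Sum>l = 1..k. sqrt (opt_error [A l, A (k + 1)]))" .
  qed

  have rank_one: "f r \<le> 2 ^ (r - 2) * f 2
      + \<kappa>' * (\<Sum>k = 2..r - 1. 2 ^ (r - 1 - k) * (\<Sum>l = 1..k. opt_error [A l, A (k + 1)]))"
    if rank: "\<forall>k\<in>{3..r}. rank (A k) = 1"
  proof (rule doubling_recurrence[OF _ assms(1)])
    fix k assume k: "2 \<le> k" "k < r"
    let ?M = "{Tr (A i) | i. 3 \<le> i \<and> i \<le> r}"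
    \<comment> \<open>Such a \<open>k\<close> exists only for \<open>r\<close> at least 3, and then
      \<open>Suc k\<close> is an admissible index, so \<open>Min\<close> is taken over a nonempty
      set.\<close>
    have M: "finite ?M" "Tr (A (Suc k)) \<in> ?M"
      using k by auto
    have "Tr (A i) > 0" if "3 \<le> i" "i \<le> r" for i
      using opt_error_Suc_le_rank_one(1)[of "i - 1" A] psd rank that by simp
    then have "\<forall>m\<in>?M. m > 0" by auto
    moreover have "Min ?M \<in> ?M" using M by (intro Min_in) auto
    ultimately have min: "0 < Min ?M" "Min ?M \<le> Tr (A (Suc k))"
      using M by (auto intro: Min_le)
    have Tr_le: "Tr (A l) + Tr (A (Suc k)) \<le> Tr (\<Sum>i = 1..r. A i)" if "l \<in> {1..k}" for l
    proof -
      \<comment> \<open>Because \<open>l\<close> differs from \<open>Suc k\<close>, the two traces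
        are distinct summands of the total trace.\<close>
      have "sum (\<lambda>i. Tr (A i)) {l, Suc k} \<le> (\<Sum>i = 1..r. Tr (A i))"
        by (rule sum_mono2) (use that k in \<open>auto intro!: psd_Tr_nonneg psd\<close>)
      then show ?thesis using that by (simp add: Tr_sum)
    qed
    have coeff: "3 * ((Tr (A l) + Tr (A (Suc k))) / Tr (A (Suc k))) \<le> \<kappa>'" if "l \<in> {1..k}" for l
    proof -
      have "(Tr (A l) + Tr (A (Suc k))) / Tr (A (Suc k)) \<le> Tr (\<Sum>i = 1..r. A i) / Min ?M"
        using that k min Tr_le
        by (intro frac_le) (auto intro!: psd_Tr_nonneg psd_sum psd)
      then show ?thesis
        unfolding assms(4) times_divide_eq_right[symmetric] by (rule mult_left_mono) simp
    qed
    have "f (Suc k) \<le> 2 * f k + 3 * (\<Sum>l = 1..k.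
        (Tr (A l) + Tr (A (Suc k))) / Tr (A (Suc k)) * opt_error [A l, A (Suc k)])"
      unfolding f_def using k rank by (intro opt_error_Suc_le_rank_one(2) psd) auto
    also have "\<dots> \<le> 2 * f k + \<kappa>' * (\<Sum>l = 1..k. opt_error [A l, A (k + 1)])"
      unfolding sum_distrib_left
    proof (intro add_left_mono sum_mono)
      fix l assume l: "l \<in> {1..k}"
      show "3 * ((Tr (A l) + Tr (A (Suc k))) / Tr (A (Suc k)) * opt_error [A l, A (Suc k)])
          \<le> \<kappa>' * opt_error [A l, A (k + 1)]"
        using mult_right_mono[OF coeff[OF l] nonneg[OF l k(2)]] by (simp only: mult.assoc Suc_eq_plus1)
    qed
    finally show "f (Suc k) \<le> 2 * f k + \<kappa>' * (\<Sum>l = 1..k. opt_error [A l, A (k + 1)])" .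
  qed
  show ?thesis
    using general rank_one unfolding f2 by (simp only: f_def) blast
qed

end
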